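(* There exist finite words $u$ over $\mathbb{Z}_{\geq 0}$ and $v$ over $\mathbb{Z}_{\geq 0} \cup \{0'\}$, of lengths $|u| = 1000$ and $|v| = 29949$, such that $\textbf{w}_{6/5} = \tau(\varphi^\infty(0'))$, where $\varphi$ is the morphism on $\mathbb{Z}_{\geq 0} \cup \{0'\}$ given by $\varphi(0') = v\,\varphi(0)$ and $\varphi(n) = u\,(n+3)$ for $n \in \mathbb{Z}_{\geq 0}$.
   Context: Words are finite or infinite sequences of letters, indexed from position $0$; a factor is a contiguous subword. Let $a, b$ be relatively prime positive integers. For a nonempty word $v$ whose length is divisible by $b$, define $v^{a/b} = v^{\lfloor a/b \rfloor} v_0 v_1 \cdots v_{t-1}$, where $t = |v|\,(a/b - \lfloor a/b\rfloor)$; such a word is called an $\frac{a}{b}$-power. A word is $\frac{a}{b}$-power-free if none of its factors is an $\frac{a}{b}$-power. For $\frac{a}{b} > 1$, $\textbf{w}_{a/b}$ denotes the lexicographically least infinite word over the alphabet $\mathbb{Z}_{\geq 0}$ that is $\frac{a}{b}$-power-free. A morphism $\varphi$ on an alphabet $\Sigma$ is a map $\Sigma \to \Sigma^*$, extended to words by concatenation. If $\varphi(c)$ begins with the letter $c$, $\varphi^\infty(c)$ denotes the infinite fixed point of $\varphi$ beginning with $c$ (limit of $\varphi^i(c)$). Here $0'$ is a new letter not in $\mathbb{Z}_{\geq 0}$, and $\tau$ is the coding (letter-to-letter morphism) with $\tau(0') = 0$ and $\tau(n) = n$ for $n \in \mathbb{Z}_{\geq 0}$, applied letterwise to infinite words.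 *)

theory Defs
  imports Complex_Main "HOL-Library.Omega_Words_Fun" "HOL-Library.Fun_Lexorder"
begin

section \<open>Fractional powers\<close>

text \<open>
  \<open>a / b - \<lfloor>a / b\<rfloor> = (a mod b) / b\<close>, so for \<open>b dvd length v\<close> the division below is exact and
  the suffix taken has length \<open>\<bar>v\<bar> (a / b - \<lfloor>a / b\<rfloor>)\<close>.
\<close>

definition frac_power :: "nat \<Rightarrow> nat \<Rightarrow> 'a list \<Rightarrow> 'a list" where
  "frac_power a b v =
     concat (replicate (a div b) v) @ take (length v * (a mod b) div b) v"

text \<open>
  The predicates below are meant for coprime \<open>a, b > 0\<close>; they are not invariant under
  cancelling a common factor of \<open>a\<close> and \<open>b\<close>.
\<close>

definition is_frac_power :: "nat \<Rightarrow> nat \<Rightarrow> 'a list \<Rightarrow> bool" where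
  "is_frac_power a b x \<longleftrightarrow> (\<exists>v. v \<noteq> [] \<and> b dvd length v \<and> x = frac_power a b v)"

definition power_free :: "nat \<Rightarrow> nat \<Rightarrow> 'a word \<Rightarrow> bool" where
  "power_free a b w \<longleftrightarrow> (\<forall>i j. \<not> is_frac_power a b (w [i \<rightarrow> j]))"


section \<open>The lexicographically least power-free word\<close>

definition is_lex_least_power_free :: "nat \<Rightarrow> nat \<Rightarrow> nat word \<Rightarrow> bool" where
  "is_lex_least_power_free a b w \<longleftrightarrow>
     power_free a b w \<and> (\<forall>w'. power_free a b w' \<longrightarrow> w = w' \<or> less_fun w w')"

definition lex_least_word :: "nat \<Rightarrow> nat \<Rightarrow> nat word" where
  "lex_least_word a b = (THE w. is_lex_least_power_free a b w)"

lemma frac_power_not_distinct: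
  assumes "0 < b" "b < a" "v \<noteq> []" "b dvd length v"
  shows "\<not> distinct (frac_power a b v)"
proof -
  from assms(3) obtain c r where v: "v = c # r" by (cases v) auto
  from assms(1,2) have q: "a div b \<noteq> 0" by (simp add: div_eq_0_iff)
  then obtain q' where q': "a div b = Suc q'" by (cases "a div b") auto
  show ?thesis
  proof (cases q')
    case 0
    with q' have "a div b = 1" by simp
    moreover from this have "a = b + a mod b" by (metis div_mult_mod_eq mult_1)
    with assms(2) have "a mod b > 0" by linarith
    moreover from assms(1,3,4) have "length v * (a mod b) div b > 0" if "a mod b > 0"
    proof -
      from assms(3,4) have "b \<le> length v" by (simp add: dvd_imp_le)
      with that have "b \<le> length v * (a mod b)" by (metis One_nat_def Suc_leI le_trans mult.right_neutral mult_le_mono2)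
      with assms(1) show ?thesis by (simp add: div_greater_zero_iff)
    qed
    ultimately obtain k where "length v * (a mod b) div b = Suc k"
      by (metis gr0_implies_Suc)
    with \<open>a div b = 1\<close> show ?thesis unfolding frac_power_def v by simp
  next
    case (Suc q'')
    with q' v show ?thesis unfolding frac_power_def by simp
  qed
qed

lemma power_free_exists:
  assumes "0 < b" "b < a"
  shows "power_free a b (\<lambda>n::nat. n)"
proof -
  have "distinct ((\<lambda>n::nat. n) [i \<rightarrow> j])" for i j
    by (simp add: subsequence_def)
  with frac_power_not_distinct[OF assms] show ?thesis
    unfolding power_free_def is_frac_power_def by metis
qed

lemma is_lex_least_power_free_unique:
  assumes "is_lex_least_power_free a b w" "is_lex_least_power_free a b w'"
  shows "w = w'"
  using assms less_fun_asym unfolding is_lex_least_power_free_def by blast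

lemma is_lex_least_power_free_exists:
  assumes "0 < b" "b < a"
  shows "\<exists>w. is_lex_least_power_free a b w"
proof -
  define P :: "nat word \<Rightarrow> bool" where "P = power_free a b"
  define nxt where "nxt p = (LEAST m. \<exists>x. P x \<and> prefix (Suc (length p)) x = p @ [m])" for p
  define pre where "pre = rec_nat [] (\<lambda>_ p. p @ [nxt p])"
  have pre0: "pre 0 = []" and preS: "pre (Suc n) = pre n @ [nxt (pre n)]" for n
    by (simp_all add: pre_def)
  have len: "length (pre n) = n" for n by (induction n) (simp_all add: pre0 preS)
  define w where "w n = nxt (pre n)" for n
  have pw: "prefix n w = pre n" for n
    by (induction n) (simp_all add: pre0 preS w_def subsequence_def)
  have ex: "\<exists>x. P x \<and> prefix n x = pre n" for n
  proof (induction n)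
    case 0
    show ?case using power_free_exists[OF assms] by (auto simp: P_def pre0)
  next
    case (Suc n)
    then obtain x where "P x" "prefix n x = pre n" by blast
    hence "\<exists>x. P x \<and> prefix (Suc (length (pre n))) x = pre n @ [x n]"
      by (intro exI[of _ x]) (simp add: len subsequence_def)
    hence "\<exists>m x. P x \<and> prefix (Suc (length (pre n))) x = pre n @ [m]"
      using \<open>P x\<close> \<open>prefix n x = pre n\<close> by (intro exI[of _ "x n"] exI[of _ x]) (simp add: len subsequence_def)
    from LeastI_ex[OF this] show ?case by (simp add: preS len nxt_def)
  qed
  have "power_free a b w"
    unfolding power_free_def
  proof (intro allI)
    fix i j
    from ex[of j] obtain x where x: "P x" "prefix j x = prefix j w" by (auto simp: pw)
    hence "w [i \<rightarrow> j] = x [i \<rightarrow> j]"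
      by (metis add_0 subsequence_drop)
    with x(1) show "\<not> is_frac_power a b (w [i \<rightarrow> j])" by (simp add: P_def power_free_def)
  qed
  moreover have "w = x \<or> less_fun w x" if "power_free a b x" for x
  proof (cases "w = x")
    case False
    hence "\<exists>n. w n \<noteq> x n" by auto
    define n where "n = (LEAST n. w n \<noteq> x n)"
    have n: "w n \<noteq> x n" "k < n \<Longrightarrow> w k = x k" for k
      using LeastI_ex[OF \<open>\<exists>n. w n \<noteq> x n\<close>] not_less_Least[of k "\<lambda>n. w n \<noteq> x n"]
      by (auto simp: n_def)
    have "prefix n x = prefix n w" using n(2) by (simp add: subsequence_def)
    hence "P x \<and> prefix (Suc (length (pre n))) x = pre n @ [x n]"
      using that by (simp add: P_def len pw[symmetric] subsequence_def)
    hence "w n \<le> x n" unfolding w_def nxt_def by (intro Least_le) blast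
    with n show ?thesis unfolding less_fun_def by (metis le_neq_implies_less)
  qed simp
  ultimately show ?thesis unfolding is_lex_least_power_free_def by blast
qed

theorem is_lex_least_power_free_lex_least_word:
  assumes "0 < b" "b < a"
  shows "is_lex_least_power_free a b (lex_least_word a b)"
  unfolding lex_least_word_def
  using is_lex_least_power_free_exists[OF assms] is_lex_least_power_free_unique
  by (metis theI')


section \<open>Morphisms and their infinite fixed points\<close>

definition morph_ext :: "('a \<Rightarrow> 'b list) \<Rightarrow> 'a list \<Rightarrow> 'b list" where
  "morph_ext \<phi> xs = concat (map \<phi> xs)"

definition morph_iter :: "('a \<Rightarrow> 'a list) \<Rightarrow> nat \<Rightarrow> 'a \<Rightarrow> 'a list" where
  "morph_iter \<phi> i c = (morph_ext \<phi> ^^ i) [c]"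

text \<open>
  Convergence in the prefix topology. Comparing with \<open>take n\<close> also forces the length of the
  \<open>i\<close>-th iterate to tend to infinity.
\<close>

definition morph_converges :: "('a \<Rightarrow> 'a list) \<Rightarrow> 'a \<Rightarrow> 'a word \<Rightarrow> bool" where
  "morph_converges \<phi> c x \<longleftrightarrow>
     (\<forall>n. \<forall>\<^sub>F i in sequentially. take n (morph_iter \<phi> i c) = prefix n x)"

definition morph_limit :: "('a \<Rightarrow> 'a list) \<Rightarrow> 'a \<Rightarrow> 'a word" where
  "morph_limit \<phi> c = (THE x. morph_converges \<phi> c x)"

lemma morph_converges_unique:
  assumes "morph_converges \<phi> c x" "morph_converges \<phi> c y"
  shows "x = y"
proof
  fix k
  have "\<forall>\<^sub>F i in sequentially. prefix (Suc k) x = prefix (Suc k) y"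
    using assms[unfolded morph_converges_def, rule_format, of "Suc k"]
    by eventually_elim simp
  hence "prefix (Suc k) x = prefix (Suc k) y" by simp
  thus "x k = y k" by (simp add: subsequence_def)
qed

lemma morph_ext_append: "morph_ext \<phi> (xs @ ys) = morph_ext \<phi> xs @ morph_ext \<phi> ys"
  by (simp add: morph_ext_def)

lemma morph_ext_pow_append:
  fixes \<phi> :: "'a \<Rightarrow> 'a list"
  shows "(morph_ext \<phi> ^^ i) (xs @ ys) = (morph_ext \<phi> ^^ i) xs @ (morph_ext \<phi> ^^ i) ys"
  by (induction i) (simp_all add: morph_ext_append)

theorem morph_converges_morph_limit:
  assumes c: "\<phi> c = c # y" and y: "y \<noteq> []" and nonerasing: "\<And>d. \<phi> d \<noteq> []"
  shows "morph_converges \<phi> c (morph_limit \<phi> c)"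
proof -
  have iter_Suc: "morph_iter \<phi> (Suc i) c = morph_iter \<phi> i c @ (morph_ext \<phi> ^^ i) y" for i
  proof -
    have "morph_iter \<phi> (Suc i) c = (morph_ext \<phi> ^^ i) ([c] @ y)"
      by (simp add: morph_iter_def morph_ext_def funpow_Suc_right c del: funpow.simps)
    thus ?thesis by (simp only: morph_ext_pow_append morph_iter_def)
  qed
  have ne: "(morph_ext \<phi> ^^ i) y \<noteq> []" for i
  proof (induction i)
    case (Suc i)
    then obtain d r where "(morph_ext \<phi> ^^ i) y = d # r" by (metis list.exhaust)
    hence "(morph_ext \<phi> ^^ Suc i) y = \<phi> d @ morph_ext \<phi> r"
      by (simp add: morph_ext_def[of \<phi> "d # r"] morph_ext_def[of \<phi> r])
    thus ?case using nonerasing by (simp del: funpow.simps)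
  qed (simp add: y)
  have len: "i \<le> length (morph_iter \<phi> i c)" for i
  proof (induction i)
    case (Suc i)
    have "length ((morph_ext \<phi> ^^ i) y) > 0" using ne by simp
    with Suc show ?case unfolding iter_Suc length_append by linarith
  qed simp
  have mono: "\<exists>z. morph_iter \<phi> j c = morph_iter \<phi> i c @ z" if "i \<le> j" for i j
    using that
  proof (induction j rule: dec_induct)
    case (step j)
    thus ?case using iter_Suc[of j] by auto
  qed simp
  define x where "x k = morph_iter \<phi> (Suc k) c ! k" for k
  have nth: "morph_iter \<phi> j c ! k = x k" if "k < j" for j k
  proof -
    from mono[of "Suc k" j] that obtain z where
      "morph_iter \<phi> j c = morph_iter \<phi> (Suc k) c @ z" by auto
    moreover have "k < length (morph_iter \<phi> (Suc k) c)" using len[of "Suc k"] by simp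
    ultimately show ?thesis by (simp add: x_def nth_append)
  qed
  have "morph_converges \<phi> c x"
    unfolding morph_converges_def
  proof
    fix n
    show "\<forall>\<^sub>F i in sequentially. take n (morph_iter \<phi> i c) = prefix n x"
      using eventually_ge_at_top[of n]
    proof eventually_elim
      case (elim i)
      show ?case
        using len[of i] elim by (intro nth_equalityI) (auto simp: nth)
    qed
  qed
  thus ?thesis unfolding morph_limit_def
    using morph_converges_unique by (metis theI)
qed


section \<open>The alphabet with an additional zero\<close>

text \<open>\<open>Zero'\<close> is the new letter $0'$, and \<open>Letter n\<close> is the letter $n$.\<close>

datatype letter = Zero' | Letter nat

fun \<tau> :: "letter \<Rightarrow> nat" where
  "\<tau> Zero' = 0"
| "\<tau> (Letter n) = n"

end

theory Submission
  imports Defs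
begin

text \<open>
  The word is \<open>w = p u (w\<^sub>0 + 3) u (w\<^sub>1 + 3) \<dots>\<close>. A 6/5-power of length \<open>6 m\<close> is a window of
  length \<open>m\<close> that is repeated at distance \<open>5 m\<close>. If the first window starts behind \<open>p\<close> and 1001
  divides \<open>m\<close>, then the last letters of the blocks contain a power for \<open>m / 1001\<close>; if 1001 does not
  divide \<open>m\<close>, then a mismatch depends on \<open>m mod 1001\<close> and on the position modulo 1001 only. The
  windows that start in \<open>p\<close> and have \<open>m < 1247\<close> or a repetition that starts in \<open>p\<close> are finitely many.
  In the other cases the repetition lies in the blocks and has a letter \<open>\<ge> 3\<close> in every 1001
  positions, which can only match one of the rare letters 3.

  For minimality, every letter less than \<open>w\<^sub>n\<close> completes a 6/5-power. Behind \<open>p\<close>, either this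
  power can be shifted along the blocks, or \<open>n\<close> is the last position of the \<open>k\<close>-th block and the
  power is the image of one that ends at \<open>k\<close>.
\<close>

section \<open>Avoiding 6/5-powers\<close>

lemma frac_power_6_5: "frac_power 6 5 v = v @ take (length v div 5) v"
  by (simp add: frac_power_def)

lemma power_free_6_5_iff:
  "power_free 6 5 w \<longleftrightarrow> (\<forall>i m. 0 < m \<longrightarrow> (\<exists>j<m. w (i + j) \<noteq> w (i + 5 * m + j)))"
proof
  assume pf: "power_free 6 5 w"
  show "\<forall>i m. 0 < m \<longrightarrow> (\<exists>j<m. w (i + j) \<noteq> w (i + 5 * m + j))"
  proof (intro allI impI, rule ccontr)
    fix i m :: nat
    assume m: "0 < m" and "\<not> (\<exists>j<m. w (i + j) \<noteq> w (i + 5 * m + j))"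
    hence eq: "\<And>j. j < m \<Longrightarrow> w (i + 5 * m + j) = w (i + j)" by metis
    define v where "v = w [i \<rightarrow> i + 5 * m]"
    have "w [i \<rightarrow> i + 6 * m] = frac_power 6 5 v"
    proof (rule nth_equalityI)
      fix k assume k: "k < length (w [i \<rightarrow> i + 6 * m])"
      show "w [i \<rightarrow> i + 6 * m] ! k = frac_power 6 5 v ! k"
        using k eq[of "k - 5 * m"]
        by (cases "k < 5 * m") (auto simp: frac_power_6_5 v_def nth_append subsequence_def)
    qed (simp add: frac_power_6_5 v_def)
    moreover have "v \<noteq> []" "5 dvd length v"
      using m by (simp_all add: v_def)
    ultimately show False
      using pf unfolding power_free_def is_frac_power_def by blast
  qed
next
  assume mis: "\<forall>i m. 0 < m \<longrightarrow> (\<exists>j<m. w (i + j) \<noteq> w (i + 5 * m + j))"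
  show "power_free 6 5 w"
    unfolding power_free_def is_frac_power_def
  proof (intro allI notI)
    fix i k
    assume "\<exists>v. v \<noteq> [] \<and> 5 dvd length v \<and> w [i \<rightarrow> k] = frac_power 6 5 v"
    then obtain v m where v: "v \<noteq> []" "length v = 5 * m" and eq: "w [i \<rightarrow> k] = v @ take m v"
      by (auto simp: frac_power_6_5)
    have m: "0 < m" using v by (cases m) auto
    have len: "k - i = 6 * m"
      using arg_cong[OF eq, of length] v by simp
    have nth: "w (i + j) = (v @ take m v) ! j" if "j < 6 * m" for j
      using that len by (simp add: eq[symmetric] subsequence_def)
    have "w (i + j) = w (i + 5 * m + j)" if "j < m" for j
      using nth[of j] nth[of "5 * m + j"] that v by (simp add: nth_append add.assoc)
    thus False using mis m by blast
  qed
qed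

text \<open>The letter \<open>c\<close> at position \<open>n\<close> would complete a 6/5-power ending there.\<close>

definition forbidden :: "nat word \<Rightarrow> nat \<Rightarrow> nat \<Rightarrow> bool" where
  "forbidden w n c \<longleftrightarrow> (\<exists>i m. 0 < m \<and> n + 1 = i + 6 * m \<and> w (i + m - 1) = c \<and>
     (\<forall>j<m - 1. w (i + j) = w (i + 5 * m + j)))"

text \<open>At the first position \<open>n\<close> where a power-free word \<open>x\<close> deviates
  from \<open>w\<close>, a smaller letter \<open>x n\<close> would be forbidden: the power that it
  completes also occurs in \<open>x\<close>, since both words agree before \<open>n\<close>.\<close>

lemma lex_least_word_6_5_eqI:
  assumes pf: "power_free 6 5 w" and forb: "\<And>n c. c < w n \<Longrightarrow> forbidden w n c"
  shows "lex_least_word 6 5 = w"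
proof -
  have "w = x \<or> less_fun w x" if x: "power_free 6 5 x" for x
  proof (cases "w = x")
    case False
    hence "\<exists>n. w n \<noteq> x n" by auto
    define n where "n = (LEAST n. w n \<noteq> x n)"
    have ne: "w n \<noteq> x n" and below: "\<And>k. k < n \<Longrightarrow> x k = w k"
      using LeastI_ex[OF \<open>\<exists>n. w n \<noteq> x n\<close>] not_less_Least[of _ "\<lambda>n. w n \<noteq> x n"]
      unfolding n_def by metis+
    have "\<not> x n < w n"
    proof
      assume "x n < w n"
      from forb[OF this] obtain i m where m: "0 < m" "n + 1 = i + 6 * m" "w (i + m - 1) = x n"
        and eq: "\<And>j. j < m - 1 \<Longrightarrow> w (i + j) = w (i + 5 * m + j)"
        unfolding forbidden_def by blast
      have "x (i + j) = x (i + 5 * m + j)" if "j < m" for j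
      proof (cases "j = m - 1")
        case True
        hence "i + 5 * m + j = n" "i + j = i + m - 1" "i + j < n" using m by auto
        thus ?thesis using below m by simp
      next
        case False
        hence "i + 5 * m + j < n" "j < m - 1" using m that by auto
        thus ?thesis using below eq by simp
      qed
      thus False using x m(1) unfolding power_free_6_5_iff by blast
    qed
    thus ?thesis using ne below unfolding less_fun_def by (metis linorder_neqE_nat)
  qed simp
  hence "is_lex_least_power_free 6 5 w"
    using pf unfolding is_lex_least_power_free_def by blast
  thus ?thesis
    using is_lex_least_power_free_lex_least_word[of 5 6] is_lex_least_power_free_unique by auto
qed

section \<open>Fixed points of the morphism\<close>

lemma morph_limit_eqI:
  assumes "morph_converges \<phi> c x"
  shows "morph_limit \<phi> c = x"
  unfolding morph_limit_def by (rule the_equality, fact assms, erule morph_converges_unique[OF _ assms])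

lemma prefix_add: "prefix (k + l) x = prefix k x @ map (\<lambda>j. x (k + j)) [0..<l]"
  by (rule nth_equalityI) (auto simp: nth_append)

text \<open>Let \<open>x\<close> be \<open>w\<close> with its first letter replaced by
  \<open>Zero'\<close>. The morphism maps every nonempty prefix of \<open>x\<close> to a longer
  prefix of \<open>x\<close>, so its iterates converge to \<open>x\<close>.\<close>

lemma tau_morph_limit_block:
  fixes w :: "nat word"
  assumes v: "v = Zero' # map (\<lambda>n. Letter (w n)) [1..<length v]"
    and w0: "w 0 = 0"
    and wu: "\<And>q r. r < length u \<Longrightarrow> w (length v + Suc (length u) * q + r) = u ! r"
    and w3: "\<And>q. w (length v + Suc (length u) * q + length u) = w q + 3"
    and phi0: "\<phi> Zero' = v @ \<phi> (Letter 0)"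
    and phi: "\<And>n. \<phi> (Letter n) = map Letter u @ [Letter (n + 3)]"
  shows "\<tau> \<circ> morph_limit \<phi> Zero' = w"
proof -
  define x where "x n = (if n = 0 then Zero' else Letter (w n))" for n
  have lv: "0 < length v" by (subst v) simp
  have vx: "prefix (length v) x = v"
    by (rule nth_equalityI) (simp, subst v, auto simp: x_def nth_Cons')
  have block: "map (\<lambda>j. x (length v + Suc (length u) * q + j)) [0..<Suc (length u)] = \<phi> (Letter (w q))"
    for q
    using lv by (intro nth_equalityI) (auto simp: x_def phi nth_append wu w3 less_Suc_eq
        simp del: mult_Suc)
  \<comment> \<open>The first letter contributes \<open>v\<close> and also block 0, because
    \<open>\<phi> Zero'\<close> ends with \<open>\<phi> (Letter 0)\<close> and
    \<open>w 0 = 0\<close>.\<close>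
  have step: "morph_ext \<phi> (prefix (Suc n) x) = prefix (length v + Suc (length u) * Suc n) x" for n
  proof (induction n)
    case 0
    have "prefix (Suc 0) x = [Zero']" by (simp add: subsequence_def x_def)
    thus ?case
      using block[of 0] by (simp only: prefix_add) (simp add: morph_ext_def phi0 w0 vx)
  next
    case (Suc n)
    have "prefix (Suc (Suc n)) x = prefix (Suc n) x @ [Letter (w (Suc n))]"
      by (simp add: subsequence_def x_def)
    moreover have "length v + Suc (length u) * Suc (Suc n) =
        (length v + Suc (length u) * Suc n) + Suc (length u)" by simp
    ultimately show ?case
      using Suc.IH block[of "Suc n"]
      by (simp only: prefix_add[where k = "length v + Suc (length u) * Suc n"] morph_ext_append)
         (simp add: morph_ext_def)
  qed
  have iter: "\<exists>l>i. morph_iter \<phi> i Zero' = prefix l x" for i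
  proof (induction i)
    case 0
    show ?case by (intro exI[of _ 1]) (simp add: morph_iter_def subsequence_def x_def)
  next
    case (Suc i)
    then obtain l where l: "l > i" "morph_iter \<phi> i Zero' = prefix l x" by blast
    then obtain l' where l': "l = Suc l'" by (cases l) auto
    have "morph_iter \<phi> (Suc i) Zero' = prefix (length v + Suc (length u) * l) x"
      using l(2) step[of l'] by (simp add: morph_iter_def l')
    moreover have "Suc i < length v + Suc (length u) * l"
    proof -
      have "l \<le> Suc (length u) * l" by simp
      thus ?thesis using l(1) lv by linarith
    qed
    ultimately show ?case by blast
  qed
  have "morph_converges \<phi> Zero' x"
    unfolding morph_converges_def
  proof
    fix n
    show "\<forall>\<^sub>F i in sequentially. take n (morph_iter \<phi> i Zero') = prefix n x"
      using eventually_ge_at_top[of n]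
    proof eventually_elim
      case (elim i)
      obtain l where "l > i" "morph_iter \<phi> i Zero' = prefix l x" using iter by blast
      thus ?case using elim by (simp add: subsequence_def take_map)
    qed
  qed
  hence "morph_limit \<phi> Zero' = x" by (rule morph_limit_eqI)
  moreover have "\<tau> \<circ> x = w" using w0 by (auto simp: x_def)
  ultimately show ?thesis by simp
qed

section \<open>The data of the word\<close>

text \<open>
  Letters are abstracted to symbols: \<open>Ge3\<close> stands for an unspecified letter \<open>\<ge> 3\<close> and \<open>Out\<close> marks
  indices outside of the tabulated range.
\<close>

datatype sym = L0 | L1 | L2 | L3 | Ge3 | Out

text \<open>Base 4, least significant digit first, below a leading digit 1 that marks the end.\<close>

fun unpack :: "nat \<Rightarrow> sym list" where
  "unpack n = (if n \<le> 1 then [] else [L0, L1, L2, L3] ! (n mod 4) # unpack (n div 4))"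

declare unpack.simps [simp del]

definition unpacks :: "nat list \<Rightarrow> sym list" where
  "unpacks ns = concat (map unpack ns)"

text \<open>
  The positions from 33 to 21889 of \<open>p\<close> have period 3643; one more letter would complete a 6/5-power
  with \<open>m = 3643\<close>.
\<close>

definition p_period :: "nat list" where
  "p_period =
    [0x12610514226504146, 0x16604544266005542, 0x16205141262055402, 0x16005542261051422,
     0x12055402660454426, 0x11051422620514126, 0x10454426600554226, 0x10514126205540266,
     0x10554226105142262, 0x15540266045442660, 0x15142262051412620, 0x15442660055422610,
     0x11412620554026604, 0x15422610514226205, 0x14026604544266005, 0x11458a05141262055,
     0x18888444448898904, 0x18994105189940055, 0x19980155089841450, 0x19881550099811510,
     0x188984045488d4504, 0x1910215588046444c, 0x10514924205560319, 0x18206544247089582,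
     0x16085941091921151, 0x11921251420658414, 0x1065442460869410a, 0x19600159212115282,
     0x15182165042474885, 0x11111920255420618, 0x14544888594009592, 0x14508994105189880,
     0x15109980155089841, 0x15049881550099811, 0x15089841450898814, 0x10099811510998015,
     0x10898814504d88155, 0x10998015508984145, 0x14988155009981151, 0x18984145089881450,
     0x19981151099801550, 0x19881450498815500, 0x19801550898414508, 0x18815500998115109,
     0x1841450898814504d, 0x18115109980155089, 0x18145049881550099, 0x11111222624105162,
     0x14146265001562221, 0x15542261051422650, 0x15402660454426600, 0x10115223514126205,
     0x15562011911322261, 0x1490815580c664408, 0x151091c2256081452, 0x15042464845460819,
     0x19450819610518216, 0x1091821a504286484, 0x1564848454a081951, 0x15941091d22165800,
     0x14809550818614608, 0x12216500256484446, 0x16504146262011512, 0x16005542261051422,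
     0x12055402660454426, 0x11051422620514126, 0x10454426600554226, 0x10514126205540266,
     0x10554226105142262, 0x15540266045442660, 0x15142262051412620, 0x15442660055422610,
     0x11412620554026604, 0x15422610514226205, 0x14c26604544266005, 0x18914205588186045,
     0x1810524a48056a051, 0x18546241091522161, 0x1858614109292414a, 0x19480458498809540,
     0x14005588984045488, 0x10458889440458899, 0x14588994005588944, 0x1c809640458889440,
     0x12215580066444845, 0x1584146085941091d, 0x19610119212514206, 0x18045848884944085,
     0x111d2226141052894, 0x15888849440859610, 0x10899410518994005, 0x10998015508984145,
     0x14988155009981151, 0x18984145089881450, 0x1498d151099801550, 0x18984045488885440,
     0x18985141099901151, 0x19981051498805540, 0x19801550898414508, 0x18514109998115109,
     0x1444488988055408d, 0x14c88994005588c84, 0x11899400558888444, 0x10898414508994105,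
     0x10594129109980155, 0x10514226205141263, 0x14544266005542261, 0x15141262055402670,
     0x15542261051422620, 0x15041662051412630, 0x11552221151022624, 0x11422650414626600,
     0x14666600554226105, 0x12115102265440]"

text \<open>\<open>0x4\<close> and \<open>0x6\<close> encode the single letters 0 and 2. The sixth
  copy of \<open>p_period\<close> is followed by 3 instead of 2, which breaks the period.\<close>

definition p :: "sym list" where
  "p = unpacks (
    [0x19880454488855400, 0x4] @
    concat (replicate 5 (p_period @ [0x6])) @ p_period @
    [0x15041472660015523, 0x10055821610524226, 0x19212514207588196, 0x18884944085961011,
     0x16141052894804584, 0x1944085961011d222, 0x10518994005588884, 0x15508984145089941,
     0x15009981151099801, 0x15089881450498815, 0x11099801550898414, 0x10498815500998115,
     0x10898414508988145, 0x10998115109980155, 0x18988145049881550, 0x19980155089841450,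
     0x19881550099811510, 0x19841450898814504, 0x19811510998015508, 0x18814504988155009,
     0x18015508984145089, 0x18155009981151099, 0x12410516281450498, 0x10156222111112226,
     0x15142265041462650, 0x15442660055422610, 0x11412620554026604, 0x11132226101152235,
     0x10c66440855620119, 0x15608145249081558, 0x14546081951091c22, 0x11051821650424648,
     0x10428648494508196, 0x14a081951091821a5, 0x12216580056484845, 0x1186146085941091d,
     0x15648444648095508, 0x16201151222165002, 0x16105142265041462, 0x16045442660055422,
     0x12051412620554026, 0x10055422610514226, 0x10554026604544266, 0x10514226205141362,
     0x14544266005542261, 0x15141262055402660, 0x15542261051422620, 0x15402660454426600,
     0x11422620514126205, 0x14426600554226105, 0x14136205540266045, 0x14226105142262051,
     0x10266045442660055, 0x1458a051412620554, 0x18884444488989041, 0x19941051899400558,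
     0x19801550898414508, 0x18815500998115109, 0x18984045488d45049, 0x110215588046444c8,
     0x15149242055603199, 0x12065442470895820, 0x10859410919211518, 0x19212514206584146,
     0x165442460869410a1, 0x16001592121152820, 0x11821650424748859, 0x11119202554206185,
     0x15448885940095921, 0x15089941051898804, 0x11099801550898414, 0x10498815500998115,
     0x10898414508988145, 0x10998115109980155, 0x18988145049881550, 0x19980155089841450,
     0x1988155009d811510, 0x19841450898814504, 0x19811510998015508, 0x18814504988155009,
     0x18015508984145089, 0x18155009981151099, 0x14145089881450498, 0x11151099801550898,
     0x11450498815500998, 0x11112226241051628, 0x11462650015622211, 0x15422610514226504,
     0x14026604544266005, 0x14226205141262055, 0x14266005542261051, 0x13159002954888454,
     0x11111322624105162, 0x14146265001562221, 0x19542261051422650, 0x152215181062a6500,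
     0x190914185c6241091, 0x10554888484448498, 0x14508994105189980, 0x15309940255089442,
     0x12215101262460416, 0x16404546261011522, 0x12015502261450426, 0x11051422660414526,
     0x10454426600554226, 0x11550236145042666, 0x15623211111222620, 0x12221111322265001,
     0x12650414626500156, 0x16600554226105142, 0x16205540266045442, 0x16105142262051412,
     0x16045442660055422, 0x12051412620554026, 0x10055422610514226, 0x10554026604544266,
     0x10514226205141262, 0x14544266005542261, 0x15141262055402660, 0x15542261051422620,
     0x15402660454426600, 0x11422620514126205, 0x14426600554226105, 0x14126205540266045,
     0x1488989041458a051, 0x18994005588884444, 0x18984145089941051, 0x19981151099801550,
     0x1a801560858414908, 0x18416500994125109, 0x11512221610125349, 0x11422650414626201,
     0x14426600554226105, 0x19448885540266045, 0x12251011623558006, 0x10414626201151322,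
     0x10a54226105142267, 0x189891410598c1650, 0x19980055488845440, 0x19841450899410518,
     0x19510119998015508, 0x16504146884544089, 0x16005542261051422, 0x12055402660454426,
     0x11051422620514126, 0x10454426600554226, 0x10069448885540266, 0x1162225101162255c,
     0x16226500156225101, 0x10259011622251011, 0x18556001991121172, 0x11051821650424748,
     0x18404648494508196, 0x11161222125102165, 0x174889850414a2520, 0x12221251021658404,
     0x12650414626500156, 0x16600554226105142, 0x16205540266045442, 0x16105142262051412,
     0x16045442660055422, 0x12051412620554026, 0x10855422610514226, 0x19211518206544246,
     0x1a544286085941091, 0x15542091911191820, 0x11159800654624608, 0x19202155203199112,
     0x15442470895920115, 0x10319919211518206, 0x146440895920115d2, 0x1448a59002a554884,
     0x19890414588888444, 0x19840454889450418, 0x14404588994005588, 0x10055889440458889,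
     0x14588894404588994, 0x1066444845c809640, 0x185941091d2215580, 0x13125142065841460,
     0x18849440859610119, 0x11410528948045848, 0x144085961011d2226, 0x15189940055888849,
     0x15089841450899410, 0x18994005588998015, 0x19440458889440458, 0x14404588994005588,
     0x1845c809640458889, 0x191d2215580066444, 0x12065841460859410, 0x10859610119212514,
     0x18948045848884944, 0x161011d2226141052, 0x10055888849440859, 0x11450899410518994,
     0x11510998015508984, 0x14504988155009981, 0x15508984145089881, 0x15009981151099801,
     0x15089881450498815, 0x11099801550898414, 0x10498815500998115, 0x10898414508988145,
     0x10998115109980155, 0x18988145049881550, 0x19980155089841450, 0x19881550099811510,
     0x19841450898814504, 0x19811510998015508, 0x12814504988155009, 0x11113122262410516,
     0x1474889950015a212, 0x16222125102165840, 0x12265041462650015, 0x12660055422610514,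
     0x11960055821610524, 0x10119212514207588, 0x15848884944085961, 0x12226141052894804,
     0x1884944085961011d, 0x19410518994005588, 0x18015508984145089, 0x18155009981151099,
     0x14145089881450498, 0x11151099801550898, 0x15540898514109998, 0x14508998105149880,
     0x11152225141069841, 0x11622650015622610, 0x16225101162225101, 0x12251011622650015,
     0x11121172025901162, 0x10424748855600199, 0x14508196105182165, 0x15102165840464849,
     0x114a2520116122212, 0x11658404748898504, 0x16500156222125102, 0x16105142265041462,
     0x16045442660055422, 0x12051412620554026, 0x10055422610514226, 0x10554026604544266,
     0x10514226205141262, 0x14544266005542261, 0x15141262055402660, 0x15542261051422620,
     0x15402660454426600, 0x11422620514126205, 0x14426600554226105, 0x66205540276045])"

definition u :: "sym list" where
  "u = unpacks
    [0x19841450898814504, 0x19811510998015508, 0x12814504988155009, 0x11111122262410516,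
     0x10414626500156222, 0x10554226105142265, 0x15540266045442660, 0x11011522351412620,
     0x18556201191132226, 0x12490815580c66440, 0x1951091c225608145, 0x16504246484546081,
     0x14945081961051821, 0x11091821a50428648, 0x10564848454a08195, 0x185941091d2216580,
     0x16480955081861460, 0x12221650025648444, 0x12650414626201151, 0x16600554226105142,
     0x16205540266045442, 0x16105142262051412, 0x16045442660055422, 0x12051412620554026,
     0x10055422610514226, 0x10554026604544266, 0x10514226205141262, 0x14544266005542261,
     0x15141262055402660, 0x15542261051422620, 0x15402660454426600, 0x16205]"

text \<open>The last letter of a block depends on an earlier letter of the word; abstracting it to
  \<open>Ge3\<close> makes the symbols periodic with period 1001 from position 29949 on.\<close>

definition sy :: "nat \<Rightarrow> sym" where
  "sy n = (if n < 29949 then p ! n else (u @ [Ge3]) ! ((n - 29949) mod 1001))"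

text \<open>
  The table has eight copies of the block \<open>u @ [Ge3]\<close>. Its indices start at 1, so that all of them
  are of the form \<open>numeral k\<close>.
\<close>

definition t :: "nat \<Rightarrow> sym" where
  "t n = (if 0 < n \<and> n \<le> 37957 then sy (n - 1) else Out)"

section \<open>Reading the packed table as equations on numerals\<close>

lemma unpack_numeral:
  "unpack (numeral num.One) = []"
  "unpack (numeral (num.Bit0 (num.Bit0 n))) = L0 # unpack (numeral n)"
  "unpack (numeral (num.Bit1 (num.Bit0 n))) = L1 # unpack (numeral n)"
  "unpack (numeral (num.Bit0 (num.Bit1 n))) = L2 # unpack (numeral n)"
  "unpack (numeral (num.Bit1 (num.Bit1 n))) = L3 # unpack (numeral n)"
proof -
  show "unpack (numeral num.One) = []"
    by (subst unpack.simps) simp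
  have *: "unpack (4 * m + k) = [L0, L1, L2, L3] ! k # unpack m" if "k < 4" "m > 0" for k m :: nat
    using that by (subst unpack.simps) auto
  have b: "(numeral (num.Bit0 k) :: nat) = 2 * numeral k"
    "(numeral (num.Bit1 k) :: nat) = 2 * numeral k + 1" for k
    by (simp_all only: numeral_Bit0[of k] numeral_Bit1[of k] mult_2)
  \<comment> \<open>Two bits of a binary numeral make up one base-4 digit.\<close>
  have e: "(numeral (num.Bit0 (num.Bit0 n)) :: nat) = 4 * numeral n + 0"
    "(numeral (num.Bit1 (num.Bit0 n)) :: nat) = 4 * numeral n + 1"
    "(numeral (num.Bit0 (num.Bit1 n)) :: nat) = 4 * numeral n + 2"
    "(numeral (num.Bit1 (num.Bit1 n)) :: nat) = 4 * numeral n + 3"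
    using b[of n] b[of "num.Bit0 n"] b[of "num.Bit1 n"] by linarith+
  show "unpack (numeral (num.Bit0 (num.Bit0 n))) = L0 # unpack (numeral n)"
    "unpack (numeral (num.Bit1 (num.Bit0 n))) = L1 # unpack (numeral n)"
    "unpack (numeral (num.Bit0 (num.Bit1 n))) = L2 # unpack (numeral n)"
    "unpack (numeral (num.Bit1 (num.Bit1 n))) = L3 # unpack (numeral n)"
    unfolding e using *[of 0 "numeral n"] *[of 1 "numeral n"] *[of 2 "numeral n"] *[of 3 "numeral n"]
    by (simp_all del: mult_numeral_left_semiring_numeral numeral_times_numeral add_numeral_left)
qed

lemma set_unpack: "set (unpack n) \<subseteq> {L0, L1, L2, L3}"
proof (induction n rule: unpack.induct)
  case (1 n)
  have "[L0, L1, L2, L3] ! (n mod 4) \<in> set [L0, L1, L2, L3]"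
    by (rule nth_mem) simp
  thus ?case using 1 by (subst unpack.simps) auto
qed

lemma set_unpacks: "set (unpacks ns) \<subseteq> {L0, L1, L2, L3}"
  using set_unpack by (fastforce simp: unpacks_def)

definition count :: "nat \<Rightarrow> sym list \<Rightarrow> nat" where
  "count i xs = i + length xs"

definition reads :: "nat \<Rightarrow> sym list \<Rightarrow> bool" where
  "reads i xs \<longleftrightarrow> (\<forall>j<length xs. t (i + j) = xs ! j)"

lemma reads_Nil: "reads i [] \<longleftrightarrow> True"
  by (simp add: reads_def)

lemma reads_Cons: "reads i (x # xs) \<longleftrightarrow> t i = x \<and> reads (Suc i) xs"
  by (auto simp: reads_def less_Suc_eq_0_disj)

lemma reads_append: "reads i (xs @ ys) \<longleftrightarrow> reads i xs \<and> reads (count i xs) ys"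
  by (induction xs arbitrary: i) (auto simp: reads_Nil reads_Cons count_def)

lemma unpacks_simps: "unpacks [] = []" "unpacks (n # ns) = unpack n @ unpacks ns"
  by (simp_all add: unpacks_def)

lemma unpacks_append: "unpacks (ms @ ns) = unpacks ms @ unpacks ns"
  by (simp add: unpacks_def)

lemma count_simps:
  "count i (unpacks []) = i"
  "count i (unpacks (a # as)) = count (count i (unpack a)) (unpacks as)"
  "count (numeral k) (unpack (numeral num.One)) = numeral k"
  "count (numeral k) (unpack (numeral (num.Bit0 (num.Bit0 n)))) =
     count (numeral (Num.inc k)) (unpack (numeral n))"
  "count (numeral k) (unpack (numeral (num.Bit1 (num.Bit0 n)))) =
     count (numeral (Num.inc k)) (unpack (numeral n))"
  "count (numeral k) (unpack (numeral (num.Bit0 (num.Bit1 n)))) =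
     count (numeral (Num.inc k)) (unpack (numeral n))"
  "count (numeral k) (unpack (numeral (num.Bit1 (num.Bit1 n)))) =
     count (numeral (Num.inc k)) (unpack (numeral n))"
  "count i (xs @ ys) = count (count i xs) ys"
  "count (numeral k) [x] = numeral (Num.inc k)"
  by (simp_all only: unpack_numeral) (simp_all add: count_def unpacks_simps numeral_inc)

text \<open>The statement that the whole table is read dissolves into one equation
  \<open>t (numeral k) = x\<close> per index; as rewrite rules, these look a letter up without
  traversing a list.\<close>

lemma reads_simps:
  "reads i (unpacks []) \<longleftrightarrow> True"
  "reads i (unpacks (a # as)) \<longleftrightarrow> reads i (unpack a) \<and> reads (count i (unpack a)) (unpacks as)"
  "reads (numeral k) (unpack (numeral num.One)) \<longleftrightarrow> True"
  "reads (numeral k) (unpack (numeral (num.Bit0 (num.Bit0 n)))) \<longleftrightarrow>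
     t (numeral k) = L0 \<and> reads (numeral (Num.inc k)) (unpack (numeral n))"
  "reads (numeral k) (unpack (numeral (num.Bit1 (num.Bit0 n)))) \<longleftrightarrow>
     t (numeral k) = L1 \<and> reads (numeral (Num.inc k)) (unpack (numeral n))"
  "reads (numeral k) (unpack (numeral (num.Bit0 (num.Bit1 n)))) \<longleftrightarrow>
     t (numeral k) = L2 \<and> reads (numeral (Num.inc k)) (unpack (numeral n))"
  "reads (numeral k) (unpack (numeral (num.Bit1 (num.Bit1 n)))) \<longleftrightarrow>
     t (numeral k) = L3 \<and> reads (numeral (Num.inc k)) (unpack (numeral n))"
  "reads i [x] \<longleftrightarrow> t i = x"
  "reads i (xs @ ys) \<longleftrightarrow> reads i xs \<and> reads (count i xs) ys"
  by (simp_all only: unpack_numeral reads_append unpacks_simps)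
     (simp_all add: reads_Nil reads_Cons numeral_inc)

lemma concat_replicate:
  "concat (replicate 5 xs) = xs @ xs @ xs @ xs @ xs"
  "concat (replicate 8 xs) = xs @ xs @ xs @ xs @ xs @ xs @ xs @ xs"
  by (simp_all add: eval_nat_numeral)

lemmas data = p_def p_period_def u_def concat_replicate unpacks_append

lemma length_p: "length p = 29949" and length_u: "length u = 1000"
proof -
  have "count (numeral num.One) p = 29950" "count (numeral num.One) u = 1001"
    by (simp_all only: data count_simps Num.inc.simps)
  thus "length p = 29949" "length u = 1000" by (simp_all add: count_def)
qed

lemma set_p: "set p \<subseteq> {L0, L1, L2, L3}" and set_u: "set u \<subseteq> {L0, L1, L2, L3}"
  unfolding p_def u_def by (rule set_unpacks)+

lemma nth_concat_replicate:
  assumes "j < k * length xs"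
  shows "concat (replicate k xs) ! j = xs ! (j mod length xs)"
  using assms
proof (induction k arbitrary: j)
  case (Suc k)
  show ?case
  proof (cases "j < length xs")
    case False
    with Suc.prems have "j - length xs < k * length xs" by simp
    from Suc.IH[OF this] False show ?thesis by (simp add: nth_append le_mod_geq)
  qed (simp add: nth_append)
qed simp

lemma reads_table: "reads (numeral num.One) (p @ concat (replicate 8 (u @ [Ge3])))"
proof -
  have len: "length (concat (replicate 8 (u @ [Ge3]))) = 8008"
    by (simp add: concat_replicate length_u)
  have "t (1 + j) = (p @ concat (replicate 8 (u @ [Ge3]))) ! j" if "j < 37957" for j
  proof (cases "j < 29949")
    case False
    hence "concat (replicate 8 (u @ [Ge3])) ! (j - 29949) = (u @ [Ge3]) ! ((j - 29949) mod 1001)"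
      using nth_concat_replicate[of "j - 29949" 8 "u @ [Ge3]"] that by (simp add: length_u)
    thus ?thesis using that False by (simp add: t_def sy_def nth_append length_p)
  qed (simp add: t_def sy_def nth_append length_p)
  thus ?thesis by (simp add: reads_def length_p len)
qed

section \<open>Checks over ranges of indices\<close>

definition range_all :: "(nat \<Rightarrow> bool) \<Rightarrow> nat \<Rightarrow> nat \<Rightarrow> bool" where
  "range_all f a n \<longleftrightarrow> (\<forall>j<n. f (a + j))"

lemma all_less_add_iff:
  fixes n k :: nat
  shows "(\<forall>j<n + k. P j) \<longleftrightarrow> (\<forall>j<n. P j) \<and> (\<forall>j<k. P (n + j))"
proof
  assume *: "(\<forall>j<n. P j) \<and> (\<forall>j<k. P (n + j))"
  show "\<forall>j<n + k. P j"
  proof (intro allI impI)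
    fix j assume "j < n + k"
    thus "P j" using * by (cases "j < n") (auto simp: not_less le_iff_add)
  qed
qed auto

lemma range_all_add: "range_all f a (n + k) \<longleftrightarrow> range_all f a n \<and> range_all f (a + n) k"
  by (simp add: range_all_def all_less_add_iff add.assoc)

text \<open>Splitting along the binary digits of the length keeps the nesting of a check over
  thousands of indices logarithmic.\<close>

lemma range_all_simps:
  "range_all f (numeral a) (numeral num.One) \<longleftrightarrow> f (numeral a)"
  "range_all f (numeral a) (numeral (num.Bit0 n)) \<longleftrightarrow>
     range_all f (numeral a) (numeral n) \<and> range_all f (numeral (a + n)) (numeral n)"
  "range_all f (numeral a) (numeral (num.Bit1 n)) \<longleftrightarrow>
     range_all f (numeral a) (numeral (num.Bit0 n)) \<and> f (numeral (a + num.Bit0 n))"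
proof -
  have one: "range_all f i 1 \<longleftrightarrow> f i" for i by (simp add: range_all_def)
  show "range_all f (numeral a) (numeral num.One) \<longleftrightarrow> f (numeral a)"
    by (simp only: numeral_One one)
  show "range_all f (numeral a) (numeral (num.Bit0 n)) \<longleftrightarrow>
     range_all f (numeral a) (numeral n) \<and> range_all f (numeral (a + n)) (numeral n)"
    by (simp only: numeral_Bit0 range_all_add numeral_add)
  have "(numeral (num.Bit1 n) :: nat) = numeral (num.Bit0 n) + 1"
    by (simp only: numeral_Bit1 numeral_Bit0)
  thus "range_all f (numeral a) (numeral (num.Bit1 n)) \<longleftrightarrow>
     range_all f (numeral a) (numeral (num.Bit0 n)) \<and> f (numeral (a + num.Bit0 n))"
    by (simp only: range_all_add one numeral_add)
qed

definition is_out :: "nat \<Rightarrow> bool" where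
  "is_out n \<longleftrightarrow> t n = Out"

text \<open>A search jumps by at most 5989 from an index of the table, hence reads nothing beyond
  37957 + 5989 = 43946.\<close>

lemma range_out: "range_all is_out 37958 6000"
  by (simp add: range_all_def is_out_def t_def)

section \<open>Comparing letters\<close>

datatype verdict = Same | Diff | Stop

text \<open>
  \<open>Same\<close> means that the letters are not known to be different. Two letters \<open>Ge3\<close> are at a distance
  divisible by 1001, where the search for mismatches below is confined to \<open>p\<close>.
\<close>

fun cmp :: "sym \<Rightarrow> sym \<Rightarrow> verdict" where
  "cmp L0 L0 = Same" | "cmp L1 L1 = Same" | "cmp L2 L2 = Same" | "cmp L3 L3 = Same"
| "cmp L3 Ge3 = Same" | "cmp Ge3 L3 = Same" | "cmp Ge3 Ge3 = Stop"
| "cmp _ Out = Stop" | "cmp Out _ = Stop" | "cmp _ _ = Diff"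

text \<open>Certain equality: unlike under \<open>cmp\<close>, the unspecified letter
  \<open>Ge3\<close> agrees with nothing.\<close>

fun agree :: "sym \<Rightarrow> sym \<Rightarrow> bool" where
  "agree L0 L0 = True" | "agree L1 L1 = True" | "agree L2 L2 = True" | "agree L3 L3 = True"
| "agree _ _ = False"

section \<open>The word and its blocks\<close>

fun val :: "sym \<Rightarrow> nat" where
  "val L0 = 0" | "val L1 = 1" | "val L2 = 2" | "val _ = 3"

text \<open>The fixed-point equation read letter by letter: block \<open>q\<close> ends with
  \<open>word q + 3\<close>, and \<open>q\<close> lies before that position.\<close>

function word :: "nat \<Rightarrow> nat" where
  "word n = (if 29949 \<le> n \<and> (n - 29949) mod 1001 = 1000 then word ((n - 29949) div 1001) + 3
     else val (sy n))"
  by auto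
termination by (relation "measure id") (auto intro: le_less_trans[OF div_le_dividend])

declare word.simps [simp del]

lemma nth_p: "n < 29949 \<Longrightarrow> p ! n \<in> {L0, L1, L2, L3}"
  using subsetD[OF set_p nth_mem] by (simp add: length_p)

lemma nth_u: "r < 1000 \<Longrightarrow> u ! r \<in> {L0, L1, L2, L3}"
  using subsetD[OF set_u nth_mem] by (simp add: length_u)

lemma sy_eq_Ge3_iff: "sy n = Ge3 \<longleftrightarrow> 29949 \<le> n \<and> (n - 29949) mod 1001 = 1000"
proof (cases "n < 29949")
  case True
  thus ?thesis using nth_p[OF True] by (auto simp: sy_def)
next
  case False
  define r where "r = (n - 29949) mod 1001"
  have "r < 1001" by (simp add: r_def)
  hence "r < 1000 \<or> r = 1000" by auto
  thus ?thesis
    using False nth_u[of r] unfolding sy_def r_def[symmetric] by (auto simp: nth_append length_u)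
qed

lemma sy_neq_Out: "sy n \<noteq> Out"
proof (cases "n < 29949")
  case True
  thus ?thesis using nth_p[OF True] by (auto simp: sy_def)
next
  case False
  define r where "r = (n - 29949) mod 1001"
  have "r < 1001" by (simp add: r_def)
  hence "r < 1000 \<or> r = 1000" by auto
  thus ?thesis
    using False nth_u[of r] unfolding sy_def r_def[symmetric] by (auto simp: nth_append length_u)
qed

lemma sy_eq_Ge3_iff_ex: "sy n = Ge3 \<longleftrightarrow> (\<exists>q. n = 30949 + 1001 * q)"
proof
  assume "sy n = Ge3"
  hence "n = 30949 + 1001 * ((n - 29949) div 1001)"
    using div_mult_mod_eq[of "n - 29949" 1001] unfolding sy_eq_Ge3_iff by linarith
  thus "\<exists>q. n = 30949 + 1001 * q" by blast
qed (auto simp: sy_eq_Ge3_iff)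

lemma word_Ge3: "sy n = Ge3 \<Longrightarrow> word n = word ((n - 29949) div 1001) + 3"
  by (subst word.simps) (simp add: sy_eq_Ge3_iff)

lemma word_val: "sy n \<noteq> Ge3 \<Longrightarrow> word n = val (sy n)"
  unfolding sy_eq_Ge3_iff by (subst word.simps) (simp only: if_False)

lemma cmp_Diff_imp_neq:
  assumes "cmp (sy i) (sy j) = Diff"
  shows "word i \<noteq> word j"
  using assms word_Ge3[of i] word_Ge3[of j] word_val[of i] word_val[of j]
  by (cases "sy i"; cases "sy j") auto

lemma agree_imp_eq:
  assumes "agree (sy i) (sy j)"
  shows "word i = word j"
  using assms word_val[of i] word_val[of j] by (cases "sy i"; cases "sy j") auto

lemma sy_shift: "29949 \<le> n \<Longrightarrow> sy (n + 1001 * q) = sy n"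
  using mod_mult_self2[of "n - 29949" 1001 q] by (simp add: sy_def)

lemma word_block:
  assumes "r < 1000"
  shows "word (29949 + 1001 * q + r) = val (u ! r)"
proof -
  have "sy (29949 + 1001 * q + r) = u ! r" "u ! r \<noteq> Ge3"
    using assms nth_u[OF assms] by (auto simp: sy_def nth_append length_u)
  thus ?thesis by (simp add: word_val)
qed

lemma word_block_last: "word (29949 + 1001 * q + 1000) = word q + 3"
  using word_Ge3[of "29949 + 1001 * q + 1000"] by (simp add: sy_eq_Ge3_iff)

section \<open>Searching for mismatches\<close>

text \<open>
  A search for a mismatch between the indices \<open>j\<close> and \<open>j + (l - k)\<close> in every window of length \<open>m\<close>.
  The current window has \<open>r\<close> unsearched positions, the last of which is \<open>k\<close>; a mismatch there
  settles every window containing \<open>k\<close>, and the search goes on in the window following \<open>k\<close>.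
\<close>

inductive search :: "nat \<Rightarrow> nat \<Rightarrow> nat \<Rightarrow> nat \<Rightarrow> bool" for m where
  Stop: "cmp (t k) (t l) = Stop \<Longrightarrow> search m k l r"
| Diff: "cmp (t k) (t l) = Diff \<Longrightarrow> search m (k + m) (l + m) m \<Longrightarrow> search m k l r"
| Same: "cmp (t (Suc k)) (t (Suc l)) = Same \<Longrightarrow> 0 < r \<Longrightarrow> search m k l r \<Longrightarrow>
    search m (Suc k) (Suc l) (Suc r)"

definition search_step :: "verdict \<Rightarrow> nat \<Rightarrow> nat \<Rightarrow> nat \<Rightarrow> nat \<Rightarrow> bool" where
  "search_step v m k l r = (case v of
     Stop \<Rightarrow> True
   | Diff \<Rightarrow> search m (k + m) (l + m) m
   | Same \<Rightarrow> \<exists>k' l' r'. k = Suc k' \<and> l = Suc l' \<and> r = Suc r' \<and> 0 < r' \<and> search m k' l' r')"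

lemma search_eq: "search m k l r \<longleftrightarrow> search_step (cmp (t k) (t l)) m k l r"
  by (subst search.simps) (auto simp: search_step_def split: verdict.split)

text \<open>A search moves backwards by decrementing three numerals, whence one equation per
  combination of parities. None decrements the numeral 1, so a window without a mismatch leaves the
  check unproved.\<close>

lemma search_step_simps:
  "search_step Stop m k l r = True"
  "search_step Diff (numeral a) (numeral b) (numeral c) r =
     search (numeral a) (numeral (b + a)) (numeral (c + a)) (numeral a)"
  "search_step Same m (numeral (num.Bit0 a)) (numeral (num.Bit0 b)) (numeral (num.Bit0 c)) =
     search m (numeral (Num.BitM a)) (numeral (Num.BitM b)) (numeral (Num.BitM c))"
  "search_step Same m (numeral (num.Bit0 a)) (numeral (num.Bit0 b)) (numeral (num.Bit1 c)) =
     search m (numeral (Num.BitM a)) (numeral (Num.BitM b)) (numeral (num.Bit0 c))"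
  "search_step Same m (numeral (num.Bit0 a)) (numeral (num.Bit1 b)) (numeral (num.Bit0 c)) =
     search m (numeral (Num.BitM a)) (numeral (num.Bit0 b)) (numeral (Num.BitM c))"
  "search_step Same m (numeral (num.Bit0 a)) (numeral (num.Bit1 b)) (numeral (num.Bit1 c)) =
     search m (numeral (Num.BitM a)) (numeral (num.Bit0 b)) (numeral (num.Bit0 c))"
  "search_step Same m (numeral (num.Bit1 a)) (numeral (num.Bit0 b)) (numeral (num.Bit0 c)) =
     search m (numeral (num.Bit0 a)) (numeral (Num.BitM b)) (numeral (Num.BitM c))"
  "search_step Same m (numeral (num.Bit1 a)) (numeral (num.Bit0 b)) (numeral (num.Bit1 c)) =
     search m (numeral (num.Bit0 a)) (numeral (Num.BitM b)) (numeral (num.Bit0 c))"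
  "search_step Same m (numeral (num.Bit1 a)) (numeral (num.Bit1 b)) (numeral (num.Bit0 c)) =
     search m (numeral (num.Bit0 a)) (numeral (num.Bit0 b)) (numeral (Num.BitM c))"
  "search_step Same m (numeral (num.Bit1 a)) (numeral (num.Bit1 b)) (numeral (num.Bit1 c)) =
     search m (numeral (num.Bit0 a)) (numeral (num.Bit0 b)) (numeral (num.Bit0 c))"
proof -
  have Suc_BitM: "(numeral (num.Bit0 k) :: nat) = Suc (numeral (Num.BitM k))" for k
    by (metis BitM_plus_one Suc_eq_plus1 numeral_One numeral_add)
  have Suc_Bit0: "(numeral (num.Bit1 k) :: nat) = Suc (numeral (num.Bit0 k))" for k
    by (simp only: numeral_Bit0 numeral_Bit1 Suc_eq_plus1)
  note defs = search_step_def verdict.case nat.inject zero_less_numeral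
  show "search_step Stop m k l r = True"
    "search_step Diff (numeral a) (numeral b) (numeral c) r =
     search (numeral a) (numeral (b + a)) (numeral (c + a)) (numeral a)"
    by (simp_all only: defs numeral_add)
  show "search_step Same m (numeral (num.Bit0 a)) (numeral (num.Bit0 b)) (numeral (num.Bit0 c)) =
     search m (numeral (Num.BitM a)) (numeral (Num.BitM b)) (numeral (Num.BitM c))"
    "search_step Same m (numeral (num.Bit0 a)) (numeral (num.Bit0 b)) (numeral (num.Bit1 c)) =
     search m (numeral (Num.BitM a)) (numeral (Num.BitM b)) (numeral (num.Bit0 c))"
    "search_step Same m (numeral (num.Bit0 a)) (numeral (num.Bit1 b)) (numeral (num.Bit0 c)) =
     search m (numeral (Num.BitM a)) (numeral (num.Bit0 b)) (numeral (Num.BitM c))"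
    "search_step Same m (numeral (num.Bit0 a)) (numeral (num.Bit1 b)) (numeral (num.Bit1 c)) =
     search m (numeral (Num.BitM a)) (numeral (num.Bit0 b)) (numeral (num.Bit0 c))"
    "search_step Same m (numeral (num.Bit1 a)) (numeral (num.Bit0 b)) (numeral (num.Bit0 c)) =
     search m (numeral (num.Bit0 a)) (numeral (Num.BitM b)) (numeral (Num.BitM c))"
    "search_step Same m (numeral (num.Bit1 a)) (numeral (num.Bit0 b)) (numeral (num.Bit1 c)) =
     search m (numeral (num.Bit0 a)) (numeral (Num.BitM b)) (numeral (num.Bit0 c))"
    "search_step Same m (numeral (num.Bit1 a)) (numeral (num.Bit1 b)) (numeral (num.Bit0 c)) =
     search m (numeral (num.Bit0 a)) (numeral (num.Bit0 b)) (numeral (Num.BitM c))"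
    "search_step Same m (numeral (num.Bit1 a)) (numeral (num.Bit1 b)) (numeral (num.Bit1 c)) =
     search m (numeral (num.Bit0 a)) (numeral (num.Bit0 b)) (numeral (num.Bit0 c))"
    by (simp_all only: defs Suc_BitM Suc_Bit0) auto
qed

lemma cmp_StopD: "cmp x y = Stop \<Longrightarrow> x = Out \<or> y = Out \<or> x = Ge3 \<and> y = Ge3"
  by (cases x; cases y) auto

text \<open>Only windows starting at \<open>k - r\<close> or later remain to be settled. For those
  allowed here \<open>Stop\<close> is impossible: \<open>Out\<close> would lie outside of the table,
  and two letters \<open>Ge3\<close> have a distance divisible by 1001, in which case the window
  lies in \<open>p\<close>. Indices of \<open>t\<close> are positions plus 1, hence
  \<open>{i<..i + m}\<close>.\<close>

lemma search_sound:
  assumes "search m k l r" "k < l" "0 < r" "r \<le> m" "r \<le> k"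
    and "k - r \<le> i" "i + (l - k) + m \<le> 37957" "1001 dvd l - k \<Longrightarrow> i + m \<le> 29949"
  shows "\<exists>j\<in>{i<..i + m}. cmp (t j) (t (j + (l - k))) = Diff"
  using assms
proof (induction arbitrary: i rule: search.induct)
  case (Stop k l r i)
  have k: "0 < k" "k \<le> i + m" "l \<le> 37957" using Stop.prems by linarith+
  hence "t k = sy (k - 1)" "t l = sy (l - 1)" using Stop.prems by (auto simp: t_def)
  hence "sy (k - 1) = Ge3" "sy (l - 1) = Ge3"
    using cmp_StopD[OF Stop.hyps] sy_neq_Out by auto
  hence k': "29949 \<le> k - 1" "(k - 1 - 29949) mod 1001 = 1000" "(l - 1 - 29949) mod 1001 = 1000"
    by (auto simp: sy_eq_Ge3_iff)
  have "k - 1 - 29949 \<le> l - 1 - 29949" using Stop.prems(1) by linarith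
  hence "1001 dvd (l - 1 - 29949) - (k - 1 - 29949)"
    by (rule mod_eq_dvd_iff_nat[THEN iffD1]) (simp only: k')
  moreover have "(l - 1 - 29949) - (k - 1 - 29949) = l - k" using k'(1) Stop.prems(1) by linarith
  ultimately have "1001 dvd l - k" by (rule subst[rotated])
  hence "i + m \<le> 29949" by (rule Stop.prems)
  thus ?case using k k'(1) by linarith
next
  case (Diff k l r i)
  show ?case
  proof (cases "i < k")
    case True
    hence "k \<in> {i<..i + m}" using Diff.prems by auto
    moreover have "k + (l - k) = l" using Diff.prems by simp
    ultimately show ?thesis using Diff.hyps(1) by metis
  next
    case False
    have "l + m - (k + m) = l - k" by simp
    thus ?thesis using Diff.IH[of i] Diff.prems False by simp
  qed
next
  case (Same k l r i)
  thus ?case by simp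
qed

text \<open>The first window consists of the indices 1 to \<open>m\<close>; its last index
  \<open>m\<close> is compared with \<open>6 * m\<close>, at distance \<open>5 * m\<close>.\<close>

definition mismatches :: "nat \<Rightarrow> bool" where
  "mismatches m \<longleftrightarrow> search m m (6 * m) m"

lemma mismatches_numeral:
  "mismatches (numeral m) \<longleftrightarrow>
     search (numeral m) (numeral m) (numeral (num.Bit0 (num.Bit1 num.One) * m)) (numeral m)"
  by (simp only: mismatches_def numeral_mult)

definition some_diff :: "nat \<Rightarrow> nat \<Rightarrow> nat \<Rightarrow> bool" where
  "some_diff k l r \<longleftrightarrow> (\<exists>j<r. cmp (t (k + j)) (t (l + j)) = Diff)"

text \<open>The \<open>if\<close> permits lazy evaluation: the upper half, which is next to the
  \<open>Ge3\<close> later on, is tested first, and the lower half only if no mismatch is found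
  there.\<close>

lemma some_diff_add:
  "some_diff k l (r + s) \<longleftrightarrow> (if some_diff (k + r) (l + r) s then True else some_diff k l r)"
  using all_less_add_iff[of r s "\<lambda>j. cmp (t (k + j)) (t (l + j)) \<noteq> Diff"]
  by (auto simp: some_diff_def add.assoc)

lemma some_diff_simps:
  "some_diff (numeral k) (numeral l) (numeral num.One) \<longleftrightarrow>
     cmp (t (numeral k)) (t (numeral l)) = Diff"
  "some_diff (numeral k) (numeral l) (numeral (num.Bit0 r)) \<longleftrightarrow>
     (if some_diff (numeral (k + r)) (numeral (l + r)) (numeral r) then True
      else some_diff (numeral k) (numeral l) (numeral r))"
  "some_diff (numeral k) (numeral l) (numeral (num.Bit1 r)) \<longleftrightarrow>
     (if some_diff (numeral (k + num.Bit0 r)) (numeral (l + num.Bit0 r)) (numeral num.One) then True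
      else some_diff (numeral k) (numeral l) (numeral (num.Bit0 r)))"
proof -
  show "some_diff (numeral k) (numeral l) (numeral num.One) \<longleftrightarrow>
     cmp (t (numeral k)) (t (numeral l)) = Diff"
    by (simp add: some_diff_def)
  show "some_diff (numeral k) (numeral l) (numeral (num.Bit0 r)) \<longleftrightarrow>
     (if some_diff (numeral (k + r)) (numeral (l + r)) (numeral r) then True
      else some_diff (numeral k) (numeral l) (numeral r))"
    by (simp only: numeral_Bit0 some_diff_add numeral_add) 
  have "(numeral (num.Bit1 r) :: nat) = numeral (num.Bit0 r) + numeral num.One"
    by (simp only: numeral_Bit1 numeral_Bit0 numeral_One)
  thus "some_diff (numeral k) (numeral l) (numeral (num.Bit1 r)) \<longleftrightarrow>
     (if some_diff (numeral (k + num.Bit0 r)) (numeral (l + num.Bit0 r)) (numeral num.One) then True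
      else some_diff (numeral k) (numeral l) (numeral (num.Bit0 r)))"
    by (simp only: some_diff_add numeral_add)
qed

text \<open>
  The letters of \<open>p\<close> are less than 4, so a \<open>Ge3\<close> of a block can only be matched by the rare letter 3.
  The 246 letters of the block before the \<open>Ge3\<close> then give a mismatch.
\<close>

fun back_mismatch_from :: "sym \<Rightarrow> nat \<Rightarrow> bool" where
  "back_mismatch_from L3 h = some_diff h 30704 246"
| "back_mismatch_from _ h = True"

definition back_mismatch :: "nat \<Rightarrow> bool" where
  "back_mismatch h \<longleftrightarrow> back_mismatch_from (t (h + 246)) h"

text \<open>The nested constructors spell the numeral 246.\<close>

lemma back_mismatch_numeral:
  "back_mismatch (numeral h) \<longleftrightarrow> back_mismatch_from (t (numeral (h + num.Bit0 (num.Bit1 (num.Bit1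
     (num.Bit0 (num.Bit1 (num.Bit1 (num.Bit1 num.One))))))))) (numeral h)"
  by (simp only: back_mismatch_def numeral_add)

section \<open>Searching for powers\<close>

text \<open>
  The values of \<open>m\<close> that are needed to forbid letters. In all but a few hundred cases 1 or 2 will do.
\<close>

definition witnesses :: "nat list" where
  "witnesses = [numeral num.One, 2, 4, 5, 10, 20, 3, 6, 7, 8, 14, 16, 25, 26, 28, 29, 31, 36, 41,
     49, 64, 79, 80, 82, 112, 129, 136, 146, 151, 175, 233, 297, 384, 555, 651, 2229, 3643]"

definition run :: "nat \<Rightarrow> nat \<Rightarrow> nat \<Rightarrow> bool" where
  "run d s n \<longleftrightarrow> (\<forall>j<n. agree (t (s + j)) (t (s + d + j)))"

text \<open>The last letter of the repetition is the one to be forbidden, so only the letters before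
  it have to agree.\<close>

definition run1 :: "nat \<Rightarrow> nat \<Rightarrow> nat \<Rightarrow> bool" where
  "run1 d s n = run d s (n - 1)"

lemma run_add: "run d s (n + k) \<longleftrightarrow> (if run d s n then run d (s + n) k else False)"
  unfolding run_def all_less_add_iff by (simp add: ac_simps)

lemma run_simps:
  "run (numeral d) (numeral s) (numeral num.One) \<longleftrightarrow> agree (t (numeral s)) (t (numeral (s + d)))"
  "run (numeral d) (numeral s) (numeral (num.Bit0 n)) \<longleftrightarrow>
     (if run (numeral d) (numeral s) (numeral n)
      then run (numeral d) (numeral (s + n)) (numeral n) else False)"
  "run (numeral d) (numeral s) (numeral (num.Bit1 n)) \<longleftrightarrow>
     (if run (numeral d) (numeral s) (numeral (num.Bit0 n))
      then run (numeral d) (numeral (s + num.Bit0 n)) (numeral num.One) else False)"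
  "run1 (numeral d) (numeral s) (numeral num.One) \<longleftrightarrow> True"
  "run1 (numeral d) (numeral s) (numeral (num.Bit0 n)) \<longleftrightarrow>
     (if run (numeral d) (numeral s) (numeral n)
      then run1 (numeral d) (numeral (s + n)) (numeral n) else False)"
  "run1 (numeral d) (numeral s) (numeral (num.Bit1 n)) \<longleftrightarrow>
     run (numeral d) (numeral s) (numeral (num.Bit0 n))"
proof -
  have Bit1: "(numeral (num.Bit1 n) :: nat) = numeral (num.Bit0 n) + numeral num.One"
    by (simp only: numeral_Bit1 numeral_Bit0 numeral_One)
  have Bit0: "(numeral (num.Bit0 n) :: nat) - 1 = numeral n + (numeral n - 1)"
    using zero_less_numeral[of n] unfolding numeral_Bit0 by linarith
  show "run (numeral d) (numeral s) (numeral num.One) \<longleftrightarrow>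
     agree (t (numeral s)) (t (numeral (s + d)))"
    by (simp add: run_def)
  show "run (numeral d) (numeral s) (numeral (num.Bit0 n)) \<longleftrightarrow>
     (if run (numeral d) (numeral s) (numeral n)
      then run (numeral d) (numeral (s + n)) (numeral n) else False)"
    by (simp only: numeral_Bit0 run_add numeral_add)
  show "run (numeral d) (numeral s) (numeral (num.Bit1 n)) \<longleftrightarrow>
     (if run (numeral d) (numeral s) (numeral (num.Bit0 n))
      then run (numeral d) (numeral (s + num.Bit0 n)) (numeral num.One) else False)"
    by (simp only: Bit1 run_add numeral_add)
  show "run1 (numeral d) (numeral s) (numeral num.One) \<longleftrightarrow> True"
    by (simp add: run1_def run_def)
  show "run1 (numeral d) (numeral s) (numeral (num.Bit0 n)) \<longleftrightarrow>
     (if run (numeral d) (numeral s) (numeral n)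
      then run1 (numeral d) (numeral (s + n)) (numeral n) else False)"
    by (simp only: run1_def Bit0 run_add numeral_add)
  show "run1 (numeral d) (numeral s) (numeral (num.Bit1 n)) \<longleftrightarrow>
     run (numeral d) (numeral s) (numeral (num.Bit0 n))"
    by (simp only: run1_def Bit1) simp
qed

text \<open>A power of length \<open>6 * m\<close> ending at \<open>n\<close> starts at
  \<open>n + 1 - 6 * m\<close>, and its first window ends at \<open>n - 5 * m\<close>. The bound
  \<open>b\<close> on the start can confine the power to the blocks.\<close>

definition hit :: "nat \<Rightarrow> nat \<Rightarrow> sym \<Rightarrow> nat \<Rightarrow> bool" where
  "hit b n a m \<longleftrightarrow> (if b + 6 * m \<le> n + numeral num.One
     then if t (n - 5 * m) = a then run1 (5 * m) (n + numeral num.One - 6 * m) m else False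
     else False)"

fun hits :: "nat \<Rightarrow> nat \<Rightarrow> sym \<Rightarrow> nat list \<Rightarrow> bool" where
  "hits b n a [] = False"
| "hits b n a (m # ms) = (if hit b n a m then True else hits b n a ms)"

text \<open>Below \<open>Ge3\<close> only 0, 1 and 2 are listed; the letters from 3 on are forbidden
  there by images of earlier powers.\<close>

fun below :: "sym \<Rightarrow> sym list" where
  "below L1 = [L0]" | "below L2 = [L0, L1]" | "below L3 = [L0, L1, L2]" | "below Ge3 = [L0, L1, L2]"
| "below _ = []"

fun all_hit :: "nat \<Rightarrow> nat \<Rightarrow> sym list \<Rightarrow> bool" where
  "all_hit b n [] = True"
| "all_hit b n (a # as) = (if hits b n a witnesses then all_hit b n as else False)"

definition greedy :: "nat \<Rightarrow> nat \<Rightarrow> bool" where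
  "greedy b n \<longleftrightarrow> all_hit b n (below (t n))"

section \<open>Evaluation\<close>

lemma nat_1_numeral: "nat 1 = numeral num.One"
  by simp

text \<open>From \<open>m = 5990\<close> on, \<open>5 * m \<ge> 29949\<close>, so every repetition
  starts behind \<open>p\<close>. Index 32952 is the end of the third block; the fourth block is
  checked with powers that start at index 29950, the first one behind \<open>p\<close>, or
  later.\<close>

lemma checks:
  shows all_mismatches: "range_all mismatches (numeral num.One) 5989"
    and back_mismatches: "range_all back_mismatch (numeral num.One) 30950"
    and greedy_initial: "range_all (greedy (numeral num.One)) (numeral num.One) 32952"
    and greedy_block: "range_all (greedy 29950) 32953 1001"
    and t_1: "t (numeral num.One) = L0"
    and t_29949: "t 29949 = L2"
proof -
  note table = reads_table[simplified data count_simps reads_simps Num.inc.simps]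
    range_out[simplified range_all_simps is_out_def Num.add_num_simps]
  have "range_all mismatches (numeral num.One) 5989 \<and> range_all back_mismatch (numeral num.One) 30950 \<and>
      range_all (greedy (numeral num.One)) (numeral num.One) 32952 \<and>
      range_all (greedy 29950) 32953 1001 \<and> t (numeral num.One) = L0 \<and> t 29949 = L2"
    by (simp only: table mismatches_numeral search_eq search_step_simps cmp.simps range_all_simps
        back_mismatch_numeral back_mismatch_from.simps some_diff_simps verdict.distinct
        greedy_def below.simps all_hit.simps hits.simps hit_def witnesses_def run_simps agree.simps
        sym.distinct numeral_plus_numeral numeral_times_numeral numeral_le_iff diff_nat_numeral
        diff_numeral_simps sub_num_simps dbl_simps dbl_inc_simps dbl_dec_simps nat_numeral
        nat_1_numeral Num.BitM.simps Num.add_num_simps Num.mult_num_simps le_num_simps less_num_simps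
        simp_thms if_True if_False cong: if_weak_cong)
  thus "range_all mismatches (numeral num.One) 5989" "range_all back_mismatch (numeral num.One) 30950"
      "range_all (greedy (numeral num.One)) (numeral num.One) 32952"
      "range_all (greedy 29950) 32953 1001" "t (numeral num.One) = L0" "t 29949 = L2"
    by blast+
qed

section \<open>Power-freeness\<close>

lemma dvd_5_mult:
  fixes m :: nat
  assumes "1001 dvd 5 * m"
  shows "1001 dvd m"
proof -
  \<comment> \<open>\<open>801 * 5 = 4 * 1001 + 1\<close>, so 801 inverts 5 modulo 1001.\<close>
  have "1001 dvd 801 * (5 * m)" using assms by (rule dvd_mult)
  moreover have "1001 dvd 1001 * (4 * m)" by simp
  ultimately have "1001 dvd 801 * (5 * m) - 1001 * (4 * m)" by (rule dvd_diff_nat)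
  thus ?thesis by simp
qed

lemma small_mismatch:
  assumes "0 < m" "m \<le> 5989" "i + 6 * m \<le> 37957" "1001 dvd m \<Longrightarrow> i + m \<le> 29949"
  shows "\<exists>j<m. cmp (sy (i + j)) (sy (i + 5 * m + j)) = Diff"
proof -
  have "mismatches m"
    using all_mismatches assms(1,2) by (auto simp: range_all_def dest!: spec[of _ "m - 1"])
  hence "search m m (6 * m) m" by (simp add: mismatches_def)
  moreover have d: "6 * m - m = 5 * m" by simp
  have "1001 dvd 6 * m - m \<Longrightarrow> i + m \<le> 29949"
    unfolding d using assms(4) dvd_5_mult by blast
  ultimately have "\<exists>j\<in>{i<..i + m}. cmp (t j) (t (j + (6 * m - m))) = Diff"
    using assms(1,3) by (intro search_sound[of m m "6 * m" m i]) simp_all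
  then obtain j where j: "i < j" "j \<le> i + m" "cmp (t j) (t (j + 5 * m)) = Diff"
    unfolding d by auto
  have "t j = sy (i + (j - i - 1))" "t (j + 5 * m) = sy (i + 5 * m + (j - i - 1))"
    using j assms(3) by (auto simp: t_def algebra_simps)
  thus ?thesis using j by (intro exI[of _ "j - i - 1"]) auto
qed

text \<open>Position 30949 is the end of the first block; by periodicity it represents the ends of
  all blocks.\<close>

lemma back_diff:
  assumes "246 \<le> k" "k < 31196" "sy k = L3"
  shows "\<exists>j. 0 < j \<and> j \<le> 246 \<and> cmp (sy (k - j)) (sy (30949 - j)) = Diff"
proof -
  have "back_mismatch (1 + (k - 246))"
    using back_mismatches assms by (auto simp: range_all_def)
  moreover have "t (1 + (k - 246) + 246) = L3" using assms by (simp add: t_def)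
  ultimately have "some_diff (1 + (k - 246)) 30704 246" unfolding back_mismatch_def by simp
  then obtain j where j: "j < 246" "cmp (t (1 + (k - 246) + j)) (t (30704 + j)) = Diff"
    by (auto simp: some_diff_def)
  have "t (1 + (k - 246) + j) = sy (k - (246 - j))" "t (30704 + j) = sy (30949 - (246 - j))"
    using j(1) assms by (auto simp: t_def)
  thus ?thesis using j by (intro exI[of _ "246 - j"]) auto
qed

lemma word_mismatch:
  assumes "0 < m"
  shows "\<exists>j<m. word (i + j) \<noteq> word (i + 5 * m + j)"
  using assms
proof (induction m arbitrary: i rule: less_induct)
  case (less m)
  show ?case
  proof (cases "29949 \<le> i")
    case True
    show ?thesis
    proof (cases "1001 dvd m")
      case dvd: True
      then obtain a where a: "m = 1001 * a" by blast
      \<comment> \<open>\<open>i\<close> lies in block \<open>q\<close>, so the blocks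
        \<open>q\<close> to \<open>q + a - 1\<close> all end inside the window; their last letters
        are those of \<open>word\<close> from \<open>q\<close> on, increased by 3.\<close>
      define q where "q = (i - 29949) div 1001"
      have q: "i \<le> 29949 + 1001 * q + 1000" "29949 + 1001 * q + 1000 < i + 1001"
        using True div_mult_mod_eq[of "i - 29949" 1001] mod_less_divisor[of 1001 "i - 29949"]
        unfolding q_def by linarith+
      obtain j where j: "j < a" "word (q + j) \<noteq> word (q + 5 * a + j)"
        using less.IH[of a q] less.prems a by auto
      define k where "k = 29949 + 1001 * (q + j) + 1000 - i"
      have "i + k = 29949 + 1001 * (q + j) + 1000"
        "i + 5 * m + k = 29949 + 1001 * (q + 5 * a + j) + 1000"
        using q a by (auto simp: k_def)
      hence "word (i + k) \<noteq> word (i + 5 * m + k)"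
        using j(2) by (simp only: word_block_last)
      moreover have "k < m" using q j(1) a by (simp add: k_def)
      ultimately show ?thesis by blast
    next
      case ndvd: False
      \<comment> \<open>Verdicts depend on \<open>sy\<close> only, which is periodic in the blocks,
        so \<open>i\<close> and \<open>m\<close> can be reduced modulo 1001. A mismatch in the
        window of length \<open>m' \<le> m\<close> suffices.\<close>
      define m' i' where "m' = m mod 1001" and "i' = 29949 + (i - 29949) mod 1001"
      have m': "0 < m'" "m' \<le> 1000" "m' \<le> m" "\<not> 1001 dvd m'"
        using ndvd
        by (auto simp: m'_def mod_greater_zero_iff_not_dvd dvd_mod_iff less_Suc_eq_le[symmetric])
      moreover have "i' < 30950" by (simp add: i'_def)
      ultimately obtain j where j: "j < m'" "cmp (sy (i' + j)) (sy (i' + 5 * m' + j)) = Diff"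
        using small_mismatch[of m' i'] by auto
      have "i = i' + 1001 * ((i - 29949) div 1001)" using True by (simp add: i'_def)
      then obtain a where i: "i = i' + 1001 * a" by blast
      have "m = m' + 1001 * (m div 1001)" by (simp add: m'_def)
      then obtain b where m: "m = m' + 1001 * b" by blast
      have "29949 \<le> i'" by (simp add: i'_def)
      hence le: "29949 \<le> i' + j" "29949 \<le> i' + 5 * m' + j" by simp_all
      have e: "i + j = i' + j + 1001 * a" using i by linarith
      have e': "i + 5 * m + j = i' + 5 * m' + j + 1001 * (a + 5 * b)"
        by (subst i, subst m) simp
      have "sy (i + j) = sy (i' + j)" unfolding e using le by (intro sy_shift)
      moreover have "sy (i + 5 * m + j) = sy (i' + 5 * m' + j)" unfolding e' using le by (intro sy_shift)
      ultimately show ?thesis using j m' cmp_Diff_imp_neq[of "i + j" "i + 5 * m + j"] by force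
    qed
  next
    case i: False
    show ?thesis
    proof (cases "1001 dvd m \<and> 29949 < i + m")
      case True
      \<comment> \<open>Position 29948 is the last one of \<open>p\<close> and carries the letter 2,
        whereas the position \<open>5 * m\<close> behind it ends a block and carries a letter at
        least 3.\<close>
      define j where "j = 29948 - i"
      obtain a where a: "m = 1001 * Suc a"
        using True less.prems by (metis dvd_def mult_0_right not0_implies_Suc not_less0)
      have "i + 5 * m + j = 30949 + 1001 * (5 * a + 4)"
        using i unfolding a j_def by simp
      hence "sy (i + 5 * m + j) = Ge3" unfolding sy_eq_Ge3_iff_ex by blast
      moreover have "sy (i + j) \<in> {L0, L1, L2}"
        using t_29949 i by (simp add: t_def j_def)
      ultimately have "cmp (sy (i + j)) (sy (i + 5 * m + j)) = Diff" by auto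
      moreover have "j < m" using True i unfolding j_def by linarith
      ultimately show ?thesis using cmp_Diff_imp_neq by blast
    next
      case False
      hence nd: "1001 dvd m \<Longrightarrow> i + m \<le> 29949" by auto
      show ?thesis
      proof (cases "m \<le> 5989 \<and> i + 6 * m \<le> 37957")
        case True
        thus ?thesis using small_mismatch[of m i] nd less.prems cmp_Diff_imp_neq by blast
      next
        case large: False
        \<comment> \<open>Here \<open>i \<le> 29948\<close>. If \<open>m \<ge> 5990\<close>, both
          bounds are clear; otherwise \<open>37957 < i + 6 * m\<close> gives
          \<open>m \<ge> 1335\<close> and \<open>i + 5 * m > 37957 - 5989\<close>.\<close>
        hence m: "1247 \<le> m" "29949 \<le> i + 5 * m" using i by auto
        \<comment> \<open>\<open>k\<close> is the first position from \<open>i + 246\<close> on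
          whose counterpart \<open>k + 5 * m\<close> ends a block. As
          \<open>k - i < 246 + 1001 = 1247 \<le> m\<close>, both \<open>k\<close> and the 246
          positions before it lie in the window.\<close>
        define s where "s = (i + 246 + 5 * m - 29949) mod 1001"
        define k where "k = i + 246 + (1000 - s)"
        have "s < 1001" by (simp add: s_def)
        hence k: "i + 246 \<le> k" "k < i + 1247" by (auto simp: k_def)
        have "i + 246 + 5 * m - 29949 = 1001 * ((i + 246 + 5 * m - 29949) div 1001) + s"
          by (simp add: s_def)
        then obtain q where "i + 246 + 5 * m - 29949 = 1001 * q + s" by blast
        hence q: "k + 5 * m = 30949 + 1001 * q"
          using m(2) \<open>s < 1001\<close> unfolding k_def by linarith
        hence Ge3: "sy (k + 5 * m) = Ge3" unfolding sy_eq_Ge3_iff_ex by blast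
        show ?thesis
        proof (cases "cmp (sy k) Ge3 = Diff")
          case True
          thus ?thesis
            using cmp_Diff_imp_neq[of k "k + 5 * m"] Ge3 k m
            by (intro exI[of _ "k - i"]) (auto simp: algebra_simps)
        next
          case False
          hence "sy k = L3 \<or> sy k = Ge3" using sy_neq_Out[of k] by (cases "sy k") auto
          \<comment> \<open>Two block ends would make 1001 divide \<open>m\<close> and thus put the
            window into \<open>p\<close>, while \<open>k\<close> would lie behind
            \<open>p\<close>.\<close>
          moreover have "sy k \<noteq> Ge3"
          proof
            assume "sy k = Ge3"
            then obtain q' where q': "k = 30949 + 1001 * q'" unfolding sy_eq_Ge3_iff_ex by blast
            hence "5 * m = 1001 * (q - q')" using q by linarith
            hence "1001 dvd m" using dvd_5_mult by simp
            thus False using nd k m q' by auto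
          qed
          ultimately obtain j where j: "0 < j" "j \<le> 246"
              "cmp (sy (k - j)) (sy (30949 - j)) = Diff"
            using back_diff[of k] k i by auto
          have "k + 5 * m - j = 30949 - j + 1001 * q" using j(2) q by linarith
          hence "sy (k + 5 * m - j) = sy (30949 - j)" using sy_shift[of "30949 - j"] j by simp
          hence "word (k - j) \<noteq> word (k + 5 * m - j)"
            using j cmp_Diff_imp_neq[of "k - j" "k + 5 * m - j"] by simp
          moreover have "i + (k - j - i) = k - j" "i + 5 * m + (k - j - i) = k + 5 * m - j"
            "k - j - i < m"
            using j k m by auto
          ultimately show ?thesis by metis
        qed
      qed
    qed
  qed
qed

section \<open>Minimality\<close>

text \<open>The agreement is one of symbols, and the power starts at \<open>b\<close> or later; for
  \<open>b \<ge> 29949\<close> it therefore survives shifts by multiples of 1001.\<close>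

definition sym_forbidden :: "nat \<Rightarrow> nat \<Rightarrow> sym \<Rightarrow> bool" where
  "sym_forbidden b n a \<longleftrightarrow> (\<exists>i m. 0 < m \<and> b \<le> i \<and> n + 1 = i + 6 * m \<and> sy (i + m - 1) = a \<and>
     (\<forall>j<m - 1. agree (sy (i + j)) (sy (i + 5 * m + j))))"

lemma all_hitD: "all_hit b n as \<Longrightarrow> a \<in> set as \<Longrightarrow> hits b n a witnesses"
  by (induction as) (auto split: if_splits)

lemma hitsD: "hits b n a ms \<Longrightarrow> \<exists>m\<in>set ms. hit b n a m"
  by (induction ms) (auto split: if_splits)

lemma greedyD:
  assumes "greedy (Suc b) (Suc n)" "n < 37957" "a \<in> set (below (sy n))"
  shows "sym_forbidden b n a"
proof -
  have "t (Suc n) = sy n" using assms by (simp add: t_def)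
  then obtain m where m: "m \<in> set witnesses" and "hit (Suc b) (Suc n) a m"
    using assms all_hitD hitsD unfolding greedy_def by metis
  hence h: "Suc b + 6 * m \<le> Suc n + 1" "t (Suc n - 5 * m) = a"
      "run (5 * m) (Suc n + 1 - 6 * m) (m - 1)"
    by (auto simp: hit_def run1_def split: if_splits)
  have m0: "0 < m" using m by (auto simp: witnesses_def)
  define i where "i = Suc n - 6 * m"
  have i: "Suc n = i + 6 * m" "b \<le> i" using h(1) by (auto simp: i_def)
  have "sy (i + m - 1) = a" using h(2) i m0 assms(2) by (simp add: t_def add.commute)
  moreover have "agree (sy (i + j)) (sy (i + 5 * m + j))" if "j < m - 1" for j
  proof -
    have "agree (t (Suc i + j)) (t (Suc i + 5 * m + j))"
      using h(3) that i by (simp add: run_def)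
    moreover have "t (Suc i + j) = sy (i + j)" "t (Suc i + 5 * m + j) = sy (i + 5 * m + j)"
      using that i assms(2) by (auto simp: t_def)
    ultimately show ?thesis by simp
  qed
  ultimately show ?thesis using m0 i unfolding sym_forbidden_def by auto
qed

lemma sym_forbidden_shift:
  assumes "sym_forbidden b n a" "29949 \<le> b"
  shows "sym_forbidden b (n + 1001 * q) a"
proof -
  from assms(1) obtain i m where im: "0 < m" "b \<le> i" "n + 1 = i + 6 * m" "sy (i + m - 1) = a"
    "\<And>j. j < m - 1 \<Longrightarrow> agree (sy (i + j)) (sy (i + 5 * m + j))"
    unfolding sym_forbidden_def by blast
  have "sy (i + 1001 * q + m - 1) = a"
    using sy_shift[of "i + m - 1" q] im assms(2) by (simp add: ac_simps)
  moreover have "agree (sy (i + 1001 * q + j)) (sy (i + 1001 * q + 5 * m + j))" if "j < m - 1" for j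
    using sy_shift[of "i + j" q] sy_shift[of "i + 5 * m + j" q] im(5)[OF that] im(2) assms(2)
    by (simp add: ac_simps)
  ultimately show ?thesis using im unfolding sym_forbidden_def
    by (intro exI[of _ "i + 1001 * q"] exI[of _ m]) auto
qed

text \<open>Positions in \<open>p\<close> and in the first three blocks are checked one by one. A
  later position is a shift of one in the fourth block, where the powers found start behind
  \<open>p\<close>.\<close>

lemma sym_forbidden_below:
  assumes "a \<in> set (below (sy n))"
  shows "\<exists>b. sym_forbidden b n a"
proof (cases "n < 32952")
  case True
  hence "greedy (Suc 0) (Suc n)" using greedy_initial by (auto simp: range_all_def)
  thus ?thesis using greedyD[of 0 n a] assms True by auto
next
  case False
  define n' q where "n' = 32952 + (n - 32952) mod 1001" and "q = (n - 32952) div 1001"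
  have n: "n = n' + 1001 * q" using False by (simp add: n'_def q_def)
  have n': "n' < 33953" "32952 \<le> n'" by (auto simp: n'_def)
  have "greedy 29950 (32953 + (n - 32952) mod 1001)"
    using greedy_block by (simp add: range_all_def)
  hence "greedy (Suc 29949) (Suc n')" by (simp add: n'_def)
  moreover have "sy n = sy n'" unfolding n using n' by (intro sy_shift) simp
  ultimately have "sym_forbidden 29949 n' a" using greedyD assms n' by simp
  thus ?thesis using sym_forbidden_shift n by blast
qed

lemma sym_forbidden_imp_forbidden:
  assumes "sym_forbidden b n a" "a \<noteq> Ge3"
  shows "forbidden word n (val a)"
  using assms agree_imp_eq word_val unfolding sym_forbidden_def forbidden_def by metis

text \<open>If \<open>n\<close> ends block \<open>k\<close> and \<open>c \<ge> 3\<close>, then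
  \<open>c - 3 < word k\<close> is forbidden at \<open>k\<close> by induction, and the image of that
  power forbids \<open>c\<close> at \<open>n\<close>. All other cases are among the letters listed
  by \<open>below\<close>.\<close>

lemma word_forbidden: "c < word n \<Longrightarrow> forbidden word n c"
proof (induction n arbitrary: c rule: less_induct)
  case (less n)
  show ?case
  proof (cases "sy n = Ge3 \<and> 3 \<le> c")
    case True
    define k where "k = (n - 29949) div 1001"
    have n: "n = 29949 + 1001 * k + 1000" using True div_mult_mod_eq[of "n - 29949" 1001]
      unfolding sy_eq_Ge3_iff k_def by linarith
    obtain d where d: "c = d + 3" using True by (metis add.commute le_Suc_ex)
    have "d < word k" using less.prems word_block_last[of k] by (simp add: n d)
    with less.IH[of k d] obtain i m where im: "0 < m" "k + 1 = i + 6 * m" "word (i + m - 1) = d"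
      "\<And>j. j < m - 1 \<Longrightarrow> word (i + j) = word (i + 5 * m + j)"
      using n unfolding forbidden_def by auto
    \<comment> \<open>\<open>I\<close> is the start of block \<open>i\<close>, and \<open>M\<close>
      is the length of \<open>m\<close> blocks.\<close>
    define I M where "I = 29949 + 1001 * i" and "M = 1001 * m"
    have "I + M - 1 = 29949 + 1001 * (i + m - 1) + 1000"
      using im(1) by (simp add: I_def M_def algebra_simps)
    hence "word (I + M - 1) = c" using im(3) d by (simp only: word_block_last)
    moreover have "word (I + j) = word (I + 5 * M + j)" if "j < M - 1" for j
    proof -
      \<comment> \<open>The letters of \<open>u\<close> are the same in all blocks; the last letters
        inherit agreement from the induction hypothesis, as \<open>j < M - 1\<close> excludes the
        end of the last block.\<close>
      define a r where "a = j div 1001" and "r = j mod 1001"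
      have j: "j = 1001 * a + r" by (simp add: a_def r_def)
      have e: "I + j = 29949 + 1001 * (i + a) + r" "I + 5 * M + j = 29949 + 1001 * (i + 5 * m + a) + r"
        by (simp_all add: I_def M_def j)
      have "r < 1001" by (simp add: r_def)
      then consider "r < 1000" | "r = 1000" by linarith
      thus ?thesis
      proof cases
        case 1
        thus ?thesis unfolding e by (simp only: word_block)
      next
        case 2
        hence "a < m - 1" using that j by (simp add: M_def)
        thus ?thesis unfolding e 2 word_block_last using im(4) by simp
      qed
    qed
    moreover have "0 < M" "n + 1 = I + 6 * M" using im by (auto simp: I_def M_def n)
    ultimately show ?thesis unfolding forbidden_def by blast
  next
    case False
    have "\<exists>a\<in>set (below (sy n)). a \<noteq> Ge3 \<and> val a = c"
    proof (cases "sy n = Ge3")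
      case True
      hence "c = 0 \<or> c = 1 \<or> c = 2" using False by auto
      thus ?thesis using True by auto
    next
      case nGe3: False
      hence "c < val (sy n)" using less.prems word_val by simp
      thus ?thesis
        using nGe3 sy_neq_Out[of n] by (cases "sy n") (auto simp: less_Suc_eq numeral_eq_Suc)
    qed
    thus ?thesis using sym_forbidden_below sym_forbidden_imp_forbidden by metis
  qed
qed

theorem theorem2p5:
  shows "\<exists>(u :: nat list) (v :: letter list) (\<phi> :: letter \<Rightarrow> letter list).
           length u = 1000 \<and> length v = 29949 \<and>
           \<phi> Zero' = v @ \<phi> (Letter 0) \<and>
           (\<forall>n. \<phi> (Letter n) = map Letter u @ [Letter (n + 3)]) \<and>
           hd (\<phi> Zero') = Zero' \<and>
           lex_least_word 6 5 = \<tau> \<circ> morph_limit \<phi> Zero'"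
proof -
  define U where "U = map val u"
  \<comment> \<open>\<open>Zero'\<close> takes the place of \<open>word 0\<close>, and 29948 further
    letters follow.\<close>
  define V where "V = Zero' # map (\<lambda>n. Letter (word n)) [1..<29949]"
  define \<phi> where "\<phi> x = (case x of Zero' \<Rightarrow> V @ map Letter U @ [Letter 3]
    | Letter n \<Rightarrow> map Letter U @ [Letter (n + 3)])" for x
  have len: "length U = 1000" "length V = 29949" by (simp_all add: U_def V_def length_u)
  have "\<tau> \<circ> morph_limit \<phi> Zero' = word"
  proof (rule tau_morph_limit_block)
    show "V = Zero' # map (\<lambda>n. Letter (word n)) [1..<length V]"
      by (simp only: len) (simp add: V_def)
    show "word 0 = 0" using t_1 by (simp add: t_def word_val)
    show "word (length V + Suc (length U) * q + r) = U ! r" if "r < length U" for q r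
      using that word_block[of r q] by (simp add: len) (simp add: U_def length_u)
    show "word (length V + Suc (length U) * q + length U) = word q + 3" for q
      using word_block_last[of q] by (simp add: len)
  qed (simp_all add: \<phi>_def)
  moreover have "lex_least_word 6 5 = word"
    using word_mismatch word_forbidden
    by (intro lex_least_word_6_5_eqI) (auto simp: power_free_6_5_iff)
  ultimately have "lex_least_word 6 5 = \<tau> \<circ> morph_limit \<phi> Zero'" by simp
  thus ?thesis using len
    by (intro exI[of _ U] exI[of _ V] exI[of _ \<phi>]) (auto simp: \<phi>_def V_def)
qed

end
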